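(* Let $n, m$ be positive integers and let $f : \mathbb{Z}^{n+m} \to \mathbb{R} \cup \{+\infty\}$ be an integrally convex function. Let $g$ be the projection of $f$ to $\mathbb{Z}^{n}$, i.e., $g(x) = \inf\{ f(x,y) \mid y \in \mathbb{Z}^{m} \}$ for $x \in \mathbb{Z}^{n}$, and assume that $g(x) > -\infty$ for all $x \in \mathbb{Z}^{n}$. Then $g : \mathbb{Z}^{n} \to \mathbb{R} \cup \{+\infty\}$ is an integrally convex function.
   Context: For $x \in \mathbb{R}^{d}$, the integral neighborhood of $x$ is $N(x) = \{ z \in \mathbb{Z}^{d} \mid |x_i - z_i| < 1 \ (i=1,\ldots,d) \}$. For $f : \mathbb{Z}^{d} \to \mathbb{R} \cup \{+\infty\}$, the local convex extension $\tilde f : \mathbb{R}^{d} \to \mathbb{R} \cup \{+\infty\}$ is defined by $\tilde f(x) = \min\{ \sum_{y \in N(x)} \lambda_y f(y) \mid \sum_{y \in N(x)} \lambda_y y = x, \ \sum_{y \in N(x)} \lambda_y = 1, \ \lambda_y \ge 0 \ (\forall y \in N(x)) \}$ (with the convention $0 \cdot (+\infty) = 0$). The function $f$ is integrally convex if $\tilde f$ is a convex function on $\mathbb{R}^{d}$. *)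

theory Defs
  imports "HOL-Analysis.Analysis"
begin

definition real_of_int_vec :: "int ^ 'd \<Rightarrow> real ^ 'd"
  where "real_of_int_vec z = (\<chi> i. real_of_int (z $ i))"

definition integral_neighborhood :: "real ^ 'd \<Rightarrow> (int ^ 'd) set"
  where "integral_neighborhood x = {z. \<forall>i. \<bar>x $ i - real_of_int (z $ i)\<bar> < 1}"

lemma finite_integral_neighborhood: "finite (integral_neighborhood x)"
proof (rule finite_subset)
  show "integral_neighborhood x \<subseteq>
      vec_lambda ` (PiE UNIV (\<lambda>i. {\<lfloor>x $ i\<rfloor> - 1 .. \<lceil>x $ i\<rceil> + 1}))"
  proof
    fix z assume z: "z \<in> integral_neighborhood x"
    have "z $ i \<in> {\<lfloor>x $ i\<rfloor> - 1 .. \<lceil>x $ i\<rceil> + 1}" for i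
    proof -
      have "\<bar>x $ i - real_of_int (z $ i)\<bar> < 1"
        using z by (simp add: integral_neighborhood_def)
      then have "x $ i - 1 < real_of_int (z $ i)" "real_of_int (z $ i) < x $ i + 1"
        by linarith+
      then have "\<lfloor>x $ i\<rfloor> - 1 \<le> z $ i" "z $ i \<le> \<lceil>x $ i\<rceil> + 1"
        by linarith+
      then show ?thesis by simp
    qed
    then have "vec_nth z \<in> PiE UNIV (\<lambda>i. {\<lfloor>x $ i\<rfloor> - 1 .. \<lceil>x $ i\<rceil> + 1})"
      by auto
    then show "z \<in> vec_lambda ` (PiE UNIV (\<lambda>i. {\<lfloor>x $ i\<rfloor> - 1 .. \<lceil>x $ i\<rceil> + 1}))"
      by (rule rev_image_eqI) simp
  qed
  show "finite (vec_lambda ` (PiE UNIV (\<lambda>i. {\<lfloor>x $ i\<rfloor> - 1 .. \<lceil>x $ i\<rceil> + 1})))"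
    by (intro finite_imageI finite_PiE) auto
qed

text \<open>
  Coefficients of the representations of \<open>x\<close> as a convex combination of the points of its
  integral neighborhood; the values of \<open>l\<close> outside the neighborhood are irrelevant.
\<close>

definition neighborhood_coeffs :: "real ^ 'd \<Rightarrow> (int ^ 'd \<Rightarrow> real) set"
  where "neighborhood_coeffs x =
    {l. (\<forall>y\<in>integral_neighborhood x. 0 \<le> l y) \<and>
        (\<Sum>y\<in>integral_neighborhood x. l y) = 1 \<and>
        (\<Sum>y\<in>integral_neighborhood x. l y *\<^sub>R real_of_int_vec y) = x}"

text \<open>
  For \<open>f\<close> with values in \<open>\<real> \<union> {+\<infinity>}\<close> the infimum below is a minimum: \<open>x\<close> lies in the convex hull
  of its finite integral neighborhood, and if some combination has finite value, then the problem
  is the minimization of a linear function over a nonempty polytope (the coefficients supported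
  where \<open>f\<close> is finite).  In \<^typ>\<open>ereal\<close> one has \<open>0 * \<infinity> = 0\<close>, as required.
\<close>

definition local_convex_extension :: "(int ^ 'd \<Rightarrow> ereal) \<Rightarrow> real ^ 'd \<Rightarrow> ereal"
  where "local_convex_extension f x =
    (INF l\<in>neighborhood_coeffs x. \<Sum>y\<in>integral_neighborhood x. ereal (l y) * f y)"

text \<open>Convexity of a function on a real vector space with values in \<open>\<real> \<union> {+\<infinity>}\<close>.\<close>

definition ereal_convex :: "('a::real_vector \<Rightarrow> ereal) \<Rightarrow> bool"
  where "ereal_convex F \<longleftrightarrow>
    (\<forall>x. F x \<noteq> -\<infinity>) \<and>
    (\<forall>x y. \<forall>t\<in>{0..1}.
      F ((1 - t) *\<^sub>R x + t *\<^sub>R y) \<le> ereal (1 - t) * F x + ereal t * F y)"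

text \<open>The first conjunct expresses that \<open>f\<close> takes values in \<open>\<real> \<union> {+\<infinity>}\<close>.\<close>

definition integrally_convex :: "(int ^ 'd \<Rightarrow> ereal) \<Rightarrow> bool"
  where "integrally_convex f \<longleftrightarrow>
    (\<forall>z. f z \<noteq> -\<infinity>) \<and> ereal_convex (local_convex_extension f)"

text \<open>The pair \<open>(x, y)\<close> as an element of the product of the two lattices, with index type the sum.\<close>

definition vec_join :: "'a ^ 'n \<Rightarrow> 'a ^ 'm \<Rightarrow> 'a ^ ('n::finite + 'm::finite)"
  where "vec_join x y = (\<chi> k. case k of Inl i \<Rightarrow> x $ i | Inr j \<Rightarrow> y $ j)"

definition projection :: "(int ^ ('n::finite + 'm::finite) \<Rightarrow> ereal) \<Rightarrow> int ^ 'n \<Rightarrow> ereal"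
  where "projection f x = (INF y. f (vec_join x y))"

end

theory Submission
  imports Defs
begin

text \<open>
  Write \<open>F\<close> and \<open>G\<close> for the local convex extensions of \<open>f\<close> and of its projection \<open>g\<close>. Then
  \<open>G x = inf\<^sub>y F (x, y)\<close>, and a partial infimum of a convex function is convex. For
  \<open>G x \<le> F (x, y)\<close>, note that \<open>N (x, y) = N x \<times> N y\<close> and pass to the marginals of the coefficients.
  Conversely, given coefficients \<open>l\<close> at \<open>x\<close>, choose nearly optimal integer points \<open>u a\<close> for
  \<open>a \<in> N x\<close>; since \<open>F (a, u a) = f (a, u a)\<close>, Jensen's inequality for \<open>F\<close> bounds its value at
  \<open>(x, \<Sum>a. l a * u a)\<close> by \<open>\<Sum>a. l a * g a\<close> up to an arbitrarily small error.
\<close>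

lemma sum_ereal_neq_MInf:
  fixes h :: "'a \<Rightarrow> ereal"
  assumes "\<And>a. a \<in> A \<Longrightarrow> h a \<noteq> -\<infinity>"
  shows "sum h A \<noteq> -\<infinity>"
  using assms by (induction A rule: infinite_finite_induct) auto

lemma ereal_mult_neq_MInf:
  assumes "0 \<le> r" "e \<noteq> -\<infinity>"
  shows "ereal r * e \<noteq> -\<infinity>"
  using assms by (cases e) auto

lemma ereal_mult_mono_left:
  assumes "0 \<le> r" "e \<le> e'"
  shows "ereal r * e \<le> ereal r * e'"
  using assms by (intro ereal_mult_left_mono) auto

text \<open>Jensen's inequality. The epigraph of \<open>F\<close>, restricted to real heights, is a
  convex set in the product space, so it contains the weighted mean of its points above the
  \<open>p a\<close>.\<close>

lemma ereal_convex_sum: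
  fixes F :: "'a::real_vector \<Rightarrow> ereal"
  assumes F: "ereal_convex F" and "finite A"
    and l: "\<And>a. a \<in> A \<Longrightarrow> 0 \<le> l a" "sum l A = 1"
  shows "F (\<Sum>a\<in>A. l a *\<^sub>R p a) \<le> (\<Sum>a\<in>A. ereal (l a) * F (p a))"
\<comment> \<open>A point of positive weight and infinite value makes the right-hand side infinite.
  Otherwise all values at points of positive weight are real.\<close>
proof (cases "\<exists>a\<in>A. 0 < l a \<and> F (p a) = \<infinity>")
  case True
  then obtain a where "a \<in> A" "ereal (l a) * F (p a) = \<infinity>" by auto
  then have "(\<Sum>a\<in>A. ereal (l a) * F (p a)) = \<infinity>"
    using \<open>finite A\<close> by (auto simp: sum_Pinfty)
  then show ?thesis by simp
next
  case False
  \<comment> \<open>The epigraph has no point above a \<open>p a\<close> of infinite value. Dropping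
    all points of weight 0 removes these, and by \<open>0 * \<infinity> = 0\<close> it changes
    neither sum.\<close>
  define B where "B = {a \<in> A. 0 < l a}"
  define r where "r a = real_of_ereal (F (p a))" for a
  have B: "finite B" "B \<subseteq> A" and l0: "\<And>a. a \<in> A - B \<Longrightarrow> l a = 0"
    using \<open>finite A\<close> l(1) by (auto simp: B_def less_le)
  have r: "F (p a) = ereal (r a)" if "a \<in> B" for a
    using that False F unfolding r_def ereal_convex_def B_def
    by (metis (no_types, lifting) ereal_real' ereal_infinity_cases mem_Collect_eq)
  have "convex {(v, s). F v \<le> ereal s}"
  proof (rule convexI)
    fix P Q :: "'a \<times> real" and a b :: real
    assume PQ: "P \<in> {(v, s). F v \<le> ereal s}" "Q \<in> {(v, s). F v \<le> ereal s}"
      and ab: "0 \<le> a" "0 \<le> b" "a + b = 1"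
    obtain v s w t where vw: "P = (v, s)" "Q = (w, t)" "F v \<le> ereal s" "F w \<le> ereal t"
      using PQ by auto
    have "F (a *\<^sub>R v + b *\<^sub>R w) \<le> ereal a * F v + ereal b * F w"
    proof -
      have "a = 1 - b" "b \<in> {0..1}" using ab by auto
      then show ?thesis using F by (simp add: ereal_convex_def)
    qed
    also have "\<dots> \<le> ereal a * ereal s + ereal b * ereal t"
      using vw ab by (intro add_mono ereal_mult_mono_left)
    finally show "a *\<^sub>R P + b *\<^sub>R Q \<in> {(v, s). F v \<le> ereal s}"
      by (simp add: vw)
  qed
  moreover have "sum l B = 1"
    using l(2) sum.mono_neutral_left[OF \<open>finite A\<close> B(2), of l] l0 by simp
  ultimately have "(\<Sum>a\<in>B. l a *\<^sub>R (p a, r a)) \<in> {(v, s). F v \<le> ereal s}"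
    using B l(1) r by (intro convex_sum) auto
  then have "F (\<Sum>a\<in>B. l a *\<^sub>R p a) \<le> ereal (\<Sum>a\<in>B. l a * r a)"
    by (auto simp: split_beta fst_sum snd_sum)
  also have "\<dots> = (\<Sum>a\<in>B. ereal (l a) * F (p a))"
    by (simp add: r flip: sum_ereal)
  also have "\<dots> = (\<Sum>a\<in>A. ereal (l a) * F (p a))"
    using l0 by (intro sum.mono_neutral_left \<open>finite A\<close> B) auto
  also have "(\<Sum>a\<in>B. l a *\<^sub>R p a) = (\<Sum>a\<in>A. l a *\<^sub>R p a)"
    using l0 by (intro sum.mono_neutral_left \<open>finite A\<close> B) auto
  finally show ?thesis .
qed

text \<open>Distinct integers differ by at least 1, so an integer point is its own sole neighbor,
  and weight 1 on it is admissible.\<close>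

lemma local_convex_extension_of_int_le:
  "local_convex_extension f (real_of_int_vec z) \<le> f z"
proof -
  have N: "integral_neighborhood (real_of_int_vec z) = {z}"
  proof -
    have "\<bar>real_of_int a - real_of_int b\<bar> < 1 \<longleftrightarrow> b = a" for a b by linarith
    then show ?thesis by (auto simp: integral_neighborhood_def real_of_int_vec_def vec_eq_iff)
  qed
  have "(\<lambda>_. 1) \<in> neighborhood_coeffs (real_of_int_vec z)"
    by (simp add: neighborhood_coeffs_def N)
  then show ?thesis
    unfolding local_convex_extension_def by (rule INF_lower2) (simp add: N one_ereal_def[symmetric])
qed

text \<open>On the finite neighborhood \<open>g\<close> has a real lower bound, which then bounds
  every convex combination of its values there.\<close>

lemma local_convex_extension_neq_MInf:
  assumes "\<And>z. g z \<noteq> -\<infinity>"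
  shows "local_convex_extension g x \<noteq> -\<infinity>"
proof -
  let ?N = "integral_neighborhood x"
  \<comment> \<open>\<open>insert 0\<close> gives \<open>Min\<close> a nonempty set.
    \<open>real_of_ereal\<close> sends \<infinity> to 0, which is harmless because every real lies
    below \<infinity>.\<close>
  define c where "c = Min (insert 0 ((\<lambda>a. real_of_ereal (g a)) ` ?N))"
  have c: "ereal c \<le> g a" if "a \<in> ?N" for a
  proof -
    have "c \<le> real_of_ereal (g a)"
      unfolding c_def using that finite_integral_neighborhood[of x] by (intro Min_le) auto
    then show ?thesis using assms[of a] by (cases "g a") auto
  qed
  have "ereal c \<le> local_convex_extension g x"
    unfolding local_convex_extension_def
  proof (rule INF_greatest)
    fix l assume l: "l \<in> neighborhood_coeffs x"
    then have "ereal c = (\<Sum>a\<in>?N. ereal (l a) * ereal c)"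
      by (simp add: neighborhood_coeffs_def flip: sum_distrib_right)
    also have "\<dots> \<le> (\<Sum>a\<in>?N. ereal (l a) * g a)"
      using l c by (intro sum_mono ereal_mult_mono_left) (auto simp: neighborhood_coeffs_def)
    finally show "ereal c \<le> (\<Sum>a\<in>?N. ereal (l a) * g a)" .
  qed
  then show ?thesis by auto
qed

lemma vec_join_nth [simp]:
  "vec_join x y $ Inl i = x $ i" "vec_join x y $ Inr j = y $ j"
  by (simp_all add: vec_join_def)

lemma vec_join_eq_iff:
  "v = vec_join x y \<longleftrightarrow> (\<forall>i. v $ Inl i = x $ i) \<and> (\<forall>j. v $ Inr j = y $ j)"
  by (auto simp: vec_eq_iff vec_join_def split: sum.split)

text \<open>Membership is tested coordinate by coordinate, hence the product form; it is what lets
  coefficients be summed over one factor.\<close>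

lemma integral_neighborhood_vec_join:
  "integral_neighborhood (vec_join x y) =
    (\<lambda>(a, b). vec_join a b) ` (integral_neighborhood x \<times> integral_neighborhood y)"
    (is "?L = ?R")
proof
  show "?L \<subseteq> ?R"
  proof
    fix z assume z: "z \<in> ?L"
    have "z = vec_join (\<chi> i. z $ Inl i) (\<chi> j. z $ Inr j)"
      by (simp add: vec_join_eq_iff)
    moreover have "\<bar>x $ i - z $ Inl i\<bar> < 1" "\<bar>y $ j - z $ Inr j\<bar> < 1" for i j
      using z[unfolded integral_neighborhood_def, simplified, THEN spec, of "Inl i"]
        z[unfolded integral_neighborhood_def, simplified, THEN spec, of "Inr j"] by auto
    ultimately show "z \<in> ?R"
      by (intro image_eqI[of _ _ "(\<chi> i. z $ Inl i, \<chi> j. z $ Inr j)"])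
        (auto simp: integral_neighborhood_def)
  qed
  show "?R \<subseteq> ?L"
    by (auto simp: integral_neighborhood_def vec_join_def split: sum.split)
qed

lemma sum_integral_neighborhood_vec_join:
  fixes x :: "real ^ 'n::finite" and y :: "real ^ 'm::finite"
  shows "(\<Sum>z\<in>integral_neighborhood (vec_join x y). h z) =
    (\<Sum>a\<in>integral_neighborhood x. \<Sum>b\<in>integral_neighborhood y. h (vec_join a b))"
proof -
  have "inj_on (\<lambda>(a, b). vec_join a b) S" for S :: "((int ^ 'n) \<times> (int ^ 'm)) set"
    unfolding inj_on_def by (auto simp: vec_join_eq_iff) (simp_all add: vec_eq_iff)
  then show ?thesis
    unfolding integral_neighborhood_vec_join
    by (subst sum.reindex) (simp_all add: sum.cartesian_product case_prod_unfold)
qed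

lemma local_convex_extension_projection_le:
  "local_convex_extension (projection f) x \<le> local_convex_extension f (vec_join x y)"
  unfolding local_convex_extension_def[of f]
proof (rule INF_greatest)
  let ?N = "integral_neighborhood"
  fix l assume l: "l \<in> neighborhood_coeffs (vec_join x y)"
  define \<mu> where "\<mu> a = (\<Sum>b\<in>?N y. l (vec_join a b))" for a
  have l0: "0 \<le> l (vec_join a b)" if "a \<in> ?N x" "b \<in> ?N y" for a b
    using l that by (auto simp: neighborhood_coeffs_def integral_neighborhood_vec_join)
  have "(\<Sum>a\<in>?N x. \<mu> a) = 1"
    using l by (simp add: neighborhood_coeffs_def \<mu>_def sum_integral_neighborhood_vec_join)
  \<comment> \<open>The \<open>Inl\<close> coordinates of the barycenter equation for
    \<open>l\<close> are the barycenter equation for the marginal \<open>\<mu>\<close>.\<close>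
  moreover have "(\<Sum>a\<in>?N x. \<mu> a *\<^sub>R real_of_int_vec a) = x"
  proof -
    have "(\<Sum>a\<in>?N x. \<Sum>b\<in>?N y. l (vec_join a b) *\<^sub>R real_of_int_vec (vec_join a b)) = vec_join x y"
      using l by (simp add: neighborhood_coeffs_def sum_integral_neighborhood_vec_join)
    then have "(\<Sum>a\<in>?N x. \<Sum>b\<in>?N y. l (vec_join a b) * real_of_int (a $ i)) = x $ i" for i
      by (auto simp: vec_join_eq_iff real_of_int_vec_def)
    then show ?thesis
      by (simp add: vec_eq_iff \<mu>_def real_of_int_vec_def sum_distrib_right)
  qed
  ultimately have "\<mu> \<in> neighborhood_coeffs x"
    using l0 by (auto simp: neighborhood_coeffs_def \<mu>_def intro!: sum_nonneg)
  then have "local_convex_extension (projection f) x \<le> (\<Sum>a\<in>?N x. ereal (\<mu> a) * projection f a)"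
    unfolding local_convex_extension_def by (rule INF_lower)
  \<comment> \<open>A possibly infinite factor distributes over the sum because all the weights are
    nonnegative.\<close>
  also have "\<dots> = (\<Sum>a\<in>?N x. \<Sum>b\<in>?N y. ereal (l (vec_join a b)) * projection f a)"
    using l0 by (intro sum.cong refl)
      (simp add: \<mu>_def sum_ereal_left_distrib flip: sum_ereal)
  also have "\<dots> \<le> (\<Sum>a\<in>?N x. \<Sum>b\<in>?N y. ereal (l (vec_join a b)) * f (vec_join a b))"
    using l0 by (intro sum_mono ereal_mult_mono_left) (auto simp: projection_def intro: INF_lower)
  finally show "local_convex_extension (projection f) x
      \<le> (\<Sum>z\<in>?N (vec_join x y). ereal (l z) * f z)"
    by (simp add: sum_integral_neighborhood_vec_join)
qed

text \<open>The infimum over real \<open>y\<close> need not be attained, so the bound is phrased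
  with a real \<open>c\<close> strictly above the extension at \<open>x\<close>.\<close>

lemma local_convex_extension_projection_approx:
  assumes F: "ereal_convex (local_convex_extension f)"
    and g: "\<And>x. projection f x \<noteq> -\<infinity>"
    and less: "local_convex_extension (projection f) x < ereal c"
  obtains y where "local_convex_extension f (vec_join x y) < ereal c"
proof -
  let ?g = "projection f" and ?N = "integral_neighborhood x"
  obtain l where l: "l \<in> neighborhood_coeffs x" and lc: "(\<Sum>a\<in>?N. ereal (l a) * ?g a) < ereal c"
    using less unfolding local_convex_extension_def INF_less_iff by auto
  have l0: "\<And>a. a \<in> ?N \<Longrightarrow> 0 \<le> l a" and l1: "sum l ?N = 1"
    and lx: "(\<Sum>a\<in>?N. l a *\<^sub>R real_of_int_vec a) = x"
    using l by (auto simp: neighborhood_coeffs_def)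
  have "(\<Sum>a\<in>?N. ereal (l a) * ?g a) \<noteq> -\<infinity>"
    using l0 g by (intro sum_ereal_neq_MInf ereal_mult_neq_MInf)
  then obtain s where s: "(\<Sum>a\<in>?N. ereal (l a) * ?g a) = ereal s"
    using lc by (cases "\<Sum>a\<in>?N. ereal (l a) * ?g a") auto
  \<comment> \<open>Half of the gap below \<open>c\<close>: the weights sum to 1, so an error of
    \<delta> at each neighbor costs \<delta> in total and keeps the bound strict.\<close>
  define \<delta> where "\<delta> = (c - s) / 2"
  have \<delta>: "0 < \<delta>" "s + \<delta> < c"
    using lc unfolding s \<delta>_def by (auto simp: field_simps)
  have "\<exists>v. f (vec_join a v) \<le> ?g a + ereal \<delta>" for a
  proof (cases "?g a = \<infinity>")
    case False
    then have "?g a < ?g a + ereal \<delta>"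
      using g[of a] \<delta> by (cases "?g a") auto
    then show ?thesis
      by (subst (asm) projection_def) (auto simp: INF_less_iff intro: less_imp_le)
  qed auto
  then obtain u where u: "\<And>a. f (vec_join a (u a)) \<le> ?g a + ereal \<delta>"
    by metis
  define p where "p a = real_of_int_vec (vec_join a (u a))" for a
  \<comment> \<open>In general \<open>y\<close> is not integral; it is the mean of the
    \<open>u a\<close> under the weights that give \<open>x\<close>, so \<open>vec_join x y\<close>
    is the mean of the \<open>p a\<close>.\<close>
  define y where "y = (\<Sum>a\<in>?N. l a *\<^sub>R real_of_int_vec (u a))"
  have "vec_join x y = (\<Sum>a\<in>?N. l a *\<^sub>R p a)"
    unfolding y_def p_def
    by (subst lx[symmetric], rule sym) (simp add: vec_join_eq_iff real_of_int_vec_def)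
  then have "local_convex_extension f (vec_join x y)
      \<le> (\<Sum>a\<in>?N. ereal (l a) * local_convex_extension f (p a))"
    using ereal_convex_sum[OF F finite_integral_neighborhood l0 l1] by simp
  also have "\<dots> \<le> (\<Sum>a\<in>?N. ereal (l a) * (?g a + ereal \<delta>))"
    using l0 u unfolding p_def
    by (intro sum_mono ereal_mult_mono_left order.trans[OF local_convex_extension_of_int_le])
  also have "\<dots> = (\<Sum>a\<in>?N. ereal (l a) * ?g a + ereal (l a * \<delta>))"
  proof (rule sum.cong[OF refl])
    fix a assume "a \<in> ?N"
    then show "ereal (l a) * (?g a + ereal \<delta>) = ereal (l a) * ?g a + ereal (l a * \<delta>)"
      using g[of a] l0[of a] by (cases "?g a") (auto simp: algebra_simps)
  qed
  also have "\<dots> = ereal (s + \<delta>)"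
    by (simp add: sum.distrib s l1 flip: sum_distrib_right)
  also have "\<dots> < ereal c"
    using \<delta> by simp
  finally show ?thesis by (rule that)
qed

lemma vec_join_convex_combination:
  fixes x x' :: "real ^ 'n::finite" and y y' :: "real ^ 'm::finite"
  shows "a *\<^sub>R vec_join x y + b *\<^sub>R vec_join x' y' =
    vec_join (a *\<^sub>R x + b *\<^sub>R x') (a *\<^sub>R y + b *\<^sub>R y')"
  by (simp add: vec_join_eq_iff)

theorem theorem3p3:
  fixes f :: "int ^ ('n::finite + 'm::finite) \<Rightarrow> ereal"
  assumes "integrally_convex f"
    and "\<And>x. projection f x > -\<infinity>"
  shows "integrally_convex (projection f)"
proof -
  let ?F = "local_convex_extension f" and ?G = "local_convex_extension (projection f)"
  have F: "ereal_convex ?F"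
    using assms(1) by (simp add: integrally_convex_def)
  have g: "projection f z \<noteq> -\<infinity>" for z
    using assms(2)[of z] by auto
  have G: "?G x \<noteq> -\<infinity>" for x
    using g by (rule local_convex_extension_neq_MInf)
  have "?G ((1 - t) *\<^sub>R x + t *\<^sub>R x') \<le> ereal (1 - t) * ?G x + ereal t * ?G x'"
    if t: "t \<in> {0..1}" for x x' t
  \<comment> \<open>For \<open>0 < t < 1\<close> an infinite value makes the right-hand side
    infinite; at \<open>t = 0\<close> and \<open>t = 1\<close> it reduces to a single value since
    \<open>0 * \<infinity> = 0\<close>.\<close>
  proof (cases "t = 0 \<or> t = 1 \<or> ?G x = \<infinity> \<or> ?G x' = \<infinity>")
    case True
    then show ?thesis
      using t G[of x] G[of x'] by (cases "?G x"; cases "?G x'")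
        (auto simp flip: zero_ereal_def one_ereal_def)
  next
    case False
    then obtain r r' where r: "?G x = ereal r" "?G x' = ereal r'"
      using G by (metis ereal_cases)
    show ?thesis
    \<comment> \<open>Near-optimal \<open>y\<close> and \<open>y'\<close> replace minimizers; their
      errors average to \<open>(1 - t) * e + t * e = e\<close>.\<close>
    proof (rule ereal_le_epsilon2)
      fix e :: real assume "0 < e"
      then have "?G x < ereal (r + e)" "?G x' < ereal (r' + e)"
        by (auto simp: r)
      then obtain y y' where y: "?F (vec_join x y) < ereal (r + e)" "?F (vec_join x' y') < ereal (r' + e)"
        by (metis local_convex_extension_projection_approx F g)
      have "?G ((1 - t) *\<^sub>R x + t *\<^sub>R x')
          \<le> ?F ((1 - t) *\<^sub>R vec_join x y + t *\<^sub>R vec_join x' y')"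
        unfolding vec_join_convex_combination by (rule local_convex_extension_projection_le)
      also have "\<dots> \<le> ereal (1 - t) * ?F (vec_join x y) + ereal t * ?F (vec_join x' y')"
        using F t by (auto simp: ereal_convex_def)
      also have "\<dots> \<le> ereal (1 - t) * ereal (r + e) + ereal t * ereal (r' + e)"
        using y t by (intro add_mono ereal_mult_mono_left) auto
      also have "\<dots> = ereal (1 - t) * ?G x + ereal t * ?G x' + ereal e"
        by (simp add: r algebra_simps)
      finally show "?G ((1 - t) *\<^sub>R x + t *\<^sub>R x')
        \<le> ereal (1 - t) * ?G x + ereal t * ?G x' + ereal e" .
    qed
  qed
  then show ?thesis
    using g G by (simp add: integrally_convex_def ereal_convex_def)
qed

end
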